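(* Let $w\in\mathbb{N}$ and $\delta>0$ be arbitrary constants. There is no deterministic online algorithm with a prediction window of length $w$ that achieves a competitive ratio of $3-\delta$ in the discrete setting, or of $2-\delta$ in the continuous setting, for the restricted data-center model.
   Context: Restricted model: given $m\in\mathbb{N}$, $\beta>0$, a non-negative convex function $f:[0,1]\to\mathbb{R}_{\ge0}$ (known in advance) and loads $\lambda_1,\dots,\lambda_T\ge0$, find $X=(x_1,\dots,x_T)$ with $x_t\ge\lambda_t$ and $x_t\in\{0,\dots,m\}$ (discrete setting) or $x_t\in[0,m]$ (continuous setting) minimizing $\sum_{t=1}^T x_tf(\lambda_t/x_t)+\beta\sum_{t=1}^T(x_t-x_{t-1})^+$ with $x_0=0$, $(y)^+=\max(0,y)$. An online algorithm with prediction window of length $w$ must choose $x_t$ irrevocably at time $t$ knowing only the inputs of times $1,\dots,t+w$ (the operating-cost data of times $t,\dots,t+w$ in addition to the past), where $w$ does not depend on $T$. An algorithm has competitive ratio $c$ if on every instance its cost is at most $c$ times the optimal offline cost. *)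

theory Defs
  imports "HOL-Analysis.Analysis"
begin

text \<open>
  An instance consists of the number of servers \<open>m\<close>, the switching cost \<open>\<beta>\<close>, the cost function
  \<open>f\<close> and the list \<open>ls\<close> of loads. Time steps are \<open>1, \<dots>, T\<close> with \<open>T = length ls\<close>, so the load
  \<open>\<lambda>\<^sub>t\<close> is \<open>ls ! (t - 1)\<close>. The function \<open>f\<close> is relevant on \<open>[0,1]\<close> only. Loads are bounded by \<open>m\<close>,
  since otherwise no feasible schedule exists.
\<close>

definition restricted_instance :: "nat \<Rightarrow> real \<Rightarrow> (real \<Rightarrow> real) \<Rightarrow> real list \<Rightarrow> bool" where
  "restricted_instance m \<beta> f ls \<longleftrightarrow>
     0 < \<beta> \<and> convex_on {0..1} f \<and> (\<forall>z\<in>{0..1}. 0 \<le> f z) \<and> (\<forall>l\<in>set ls. 0 \<le> l \<and> l \<le> real m)"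

definition discrete_states :: "nat \<Rightarrow> real set" where
  "discrete_states m = real ` {0..m}"

definition continuous_states :: "nat \<Rightarrow> real set" where
  "continuous_states m = {0..real m}"

text \<open>
  A schedule is a function \<open>x\<close> of time, of which only the values at \<open>0, \<dots>, T\<close> matter. The
  parameter \<open>S\<close> is the set of admissible states.
\<close>

definition feasible :: "real set \<Rightarrow> real list \<Rightarrow> (nat \<Rightarrow> real) \<Rightarrow> bool" where
  "feasible S ls x \<longleftrightarrow> x 0 = 0 \<and> (\<forall>t\<in>{1..length ls}. x t \<in> S \<and> ls ! (t - 1) \<le> x t)"

text \<open>
  For \<open>x t = 0\<close>, which a feasible schedule allows only if the load is \<open>0\<close>, the operating cost
  \<open>x t * f (\<lambda>\<^sub>t / x t)\<close> is \<open>0\<close>, as it should be.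
\<close>

definition schedule_cost :: "real \<Rightarrow> (real \<Rightarrow> real) \<Rightarrow> real list \<Rightarrow> (nat \<Rightarrow> real) \<Rightarrow> real" where
  "schedule_cost \<beta> f ls x =
     (\<Sum>t = 1..length ls. x t * f (ls ! (t - 1) / x t))
     + \<beta> * (\<Sum>t = 1..length ls. max 0 (x t - x (t - 1)))"

definition opt_cost :: "real set \<Rightarrow> real \<Rightarrow> (real \<Rightarrow> real) \<Rightarrow> real list \<Rightarrow> real" where
  "opt_cost S \<beta> f ls = (INF x\<in>{x. feasible S ls x}. schedule_cost \<beta> f ls x)"

text \<open>
  A deterministic online algorithm knows \<open>m\<close>, \<open>\<beta>\<close> and \<open>f\<close> in advance. With a prediction window of
  length \<open>w\<close>, its decision at time \<open>t\<close> is a function of these, of \<open>t\<close>, and of the loads at the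
  times \<open>1, \<dots>, t + w\<close> (or \<open>1, \<dots>, T\<close> if \<open>t + w > T\<close>). Its earlier decisions need not be
  passed as an argument because they are determined by the same data.
\<close>

type_synonym online_algorithm = "nat \<Rightarrow> real \<Rightarrow> (real \<Rightarrow> real) \<Rightarrow> nat \<Rightarrow> real list \<Rightarrow> real"

definition online_schedule ::
    "nat \<Rightarrow> online_algorithm \<Rightarrow> nat \<Rightarrow> real \<Rightarrow> (real \<Rightarrow> real) \<Rightarrow> real list \<Rightarrow> nat \<Rightarrow> real" where
  "online_schedule w A m \<beta> f ls t = (if t = 0 then 0 else A m \<beta> f t (take (t + w) ls))"

text \<open>
  The setting is given by \<open>S\<close>, which maps the number of servers to the set of admissible states.
\<close>

definition achieves_competitive_ratio ::
    "(nat \<Rightarrow> real set) \<Rightarrow> nat \<Rightarrow> online_algorithm \<Rightarrow> real \<Rightarrow> bool" where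
  "achieves_competitive_ratio S w A c \<longleftrightarrow>
     (\<forall>m \<beta> f ls. restricted_instance m \<beta> f ls \<longrightarrow>
        feasible (S m) ls (online_schedule w A m \<beta> f ls) \<and>
        schedule_cost \<beta> f ls (online_schedule w A m \<beta> f ls) \<le> c * opt_cost (S m) \<beta> f ls)"

end

theory Submission
  imports Defs
begin

text \<open>
  With \<open>m = 2\<close>, \<open>\<beta> = 2\<close> and \<open>f z = \<epsilon> \<bar>1 - 2 z\<bar>\<close>, the loads \<open>1/2\<close> and \<open>1\<close> give the operating costs
  \<open>\<epsilon> \<bar>x - 1\<bar>\<close> and \<open>\<epsilon> \<bar>x - 2\<bar>\<close>, so the problem is a walk on \<open>[0,1]\<close> with position \<open>a = max 0 (x - 1)\<close>,
  targets \<open>0\<close> and \<open>1\<close>, and (up to an additive constant) switching cost equal to the total variation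
  of \<open>a\<close>. The adversary fixes the target of time \<open>n + 1\<close> from the position at time \<open>n - w\<close>. As \<open>\<epsilon>\<close> is
  small compared to \<open>1/w\<close>, the cost of the algorithm is nearly \<open>E + V\<close>, where \<open>V\<close> is the variation and \<open>E\<close>
  the operating cost of the position delayed by \<open>w + 1\<close> steps.

  Discrete setting: the target is always opposite to the delayed position, so that \<open>E = \<epsilon> T\<close>. The
  schedules resting at \<open>0\<close>, resting at \<open>1\<close>, and following the target have total cost about
  \<open>\<epsilon> T + V = E + V\<close>, so the optimum is at most a third of it.

  Continuous setting: let \<open>b\<close> be the barycenter of the work function of the two states, which moves by
  \<open>\<epsilon>/2\<close> towards each target. The adversary pushes \<open>b\<close> away from the delayed position. The optimum is
  at most the variation of \<open>b\<close>, and a potential shows that \<open>E + V\<close> is nearly twice this variation.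
\<close>

section \<open>Walks on \<open>[0,1]\<close>: cost, variation and delay\<close>

definition walk_cost :: "real \<Rightarrow> (nat \<Rightarrow> bool) \<Rightarrow> (nat \<Rightarrow> real) \<Rightarrow> nat \<Rightarrow> real" where
  "walk_cost \<epsilon> g a N = (\<Sum>n<N. \<epsilon> * \<bar>a (Suc n) - of_bool (g n)\<bar> + \<bar>a (Suc n) - a n\<bar>)"

definition variation :: "(nat \<Rightarrow> real) \<Rightarrow> nat \<Rightarrow> real" where
  "variation a N = (\<Sum>n<N. \<bar>a (Suc n) - a n\<bar>)"

text \<open>
  The target \<open>g n\<close> belongs to time \<open>n + 1\<close>, so \<open>a (n - w)\<close> is the last position it may depend on.
  The truncated subtraction is intended: positions before time \<open>0\<close> equal the initial one.
\<close>

definition delayed_cost :: "real \<Rightarrow> nat \<Rightarrow> (nat \<Rightarrow> bool) \<Rightarrow> (nat \<Rightarrow> real) \<Rightarrow> nat \<Rightarrow> real" where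
  "delayed_cost \<epsilon> w g a N = (\<Sum>n<N. \<epsilon> * \<bar>a (n - w) - of_bool (g n)\<bar>)"

lemma variation_Suc: "variation a (Suc N) = variation a N + \<bar>a (Suc N) - a N\<bar>"
  by (simp add: variation_def)

lemma variation_nonneg: "0 \<le> variation a N"
  by (simp add: variation_def sum_nonneg)

lemma variation_mono: "M \<le> N \<Longrightarrow> variation a M \<le> variation a N"
  unfolding variation_def by (rule sum_mono2) auto

lemma variation_delay_Suc: "(\<Sum>n<N. \<bar>a (Suc n - w) - a (n - w)\<bar>) = variation a (N - w)"
proof (induction N)
  case (Suc N)
  then show ?case
    by (cases "w \<le> N") (simp_all add: Suc_diff_le variation_Suc)
qed (simp add: variation_def)

lemma variation_delay: "(\<Sum>n<N. \<bar>a (n - w) - a (n - Suc w)\<bar>) \<le> variation a N"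
proof (cases N)
  case (Suc M)
  have "(\<Sum>n<N. \<bar>a (n - w) - a (n - Suc w)\<bar>) = variation a (M - w)"
    unfolding Suc sum.lessThan_Suc_shift variation_delay_Suc[symmetric] by simp
  then show ?thesis
    using variation_mono[of "M - w" N a] Suc by simp
qed (simp add: variation_def)

text \<open>Each step of \<open>a\<close> lies in at most \<open>w + 1\<close> of the windows from
  \<open>n - w\<close> to \<open>n + 1\<close>. The induction adds one delayed copy of the variation
  per unit of delay.\<close>

lemma delay_displacement_le:
  "(\<Sum>n<N. \<bar>a (Suc n) - a (n - w)\<bar>) \<le> (real w + 1) * variation a N"
proof (induction w)
  case (Suc w)
  have "(\<Sum>n<N. \<bar>a (Suc n) - a (n - Suc w)\<bar>)
      \<le> (\<Sum>n<N. \<bar>a (Suc n) - a (n - w)\<bar> + \<bar>a (n - w) - a (n - Suc w)\<bar>)"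
    by (rule sum_mono) linarith
  also have "\<dots> \<le> (real w + 1) * variation a N + variation a N"
    unfolding sum.distrib using Suc variation_delay[of a w N] by linarith
  finally show ?case
    by (simp add: algebra_simps)
qed (simp add: variation_def)

text \<open>Delaying the position changes the operating cost by at most
  \<open>\<epsilon> * (w + 1)\<close> times the variation. Shrinking the delayed cost by the same
  factor only weakens the bound and yields a multiple of the sum.\<close>

lemma walk_cost_ge_delayed:
  assumes "0 \<le> \<epsilon>"
  shows "(1 - \<epsilon> * (real w + 1)) * (delayed_cost \<epsilon> w g a N + variation a N) \<le> walk_cost \<epsilon> g a N"
proof -
  have "delayed_cost \<epsilon> w g a N - \<epsilon> * (\<Sum>n<N. \<bar>a (Suc n) - a (n - w)\<bar>)
      = (\<Sum>n<N. \<epsilon> * (\<bar>a (n - w) - of_bool (g n)\<bar> - \<bar>a (Suc n) - a (n - w)\<bar>))"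
    unfolding delayed_cost_def sum_distrib_left sum_subtractf[symmetric]
    by (simp add: algebra_simps)
  also have "\<dots> \<le> (\<Sum>n<N. \<epsilon> * \<bar>a (Suc n) - of_bool (g n)\<bar>)"
    by (intro sum_mono mult_left_mono) (use assms in auto)
  also have "\<dots> = walk_cost \<epsilon> g a N - variation a N"
    unfolding walk_cost_def variation_def by (simp add: sum.distrib)
  finally have "delayed_cost \<epsilon> w g a N + variation a N
      - \<epsilon> * (\<Sum>n<N. \<bar>a (Suc n) - a (n - w)\<bar>) \<le> walk_cost \<epsilon> g a N"
    by linarith
  moreover have "\<epsilon> * (\<Sum>n<N. \<bar>a (Suc n) - a (n - w)\<bar>) \<le> \<epsilon> * ((real w + 1) * variation a N)"
    using assms by (intro mult_left_mono delay_displacement_le)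
  moreover have "0 \<le> \<epsilon> * (real w + 1) * delayed_cost \<epsilon> w g a N"
    using assms unfolding delayed_cost_def by (intro mult_nonneg_nonneg sum_nonneg) auto
  ultimately show ?thesis
    by (simp add: algebra_simps)
qed

lemma walk_cost_cong:
  assumes "\<And>n. n \<le> N \<Longrightarrow> a n = a' n"
  shows "walk_cost \<epsilon> g a N = walk_cost \<epsilon> g a' N"
  unfolding walk_cost_def using assms by (intro sum.cong) auto

lemma walk_cost_upd:
  "walk_cost \<epsilon> g (z(Suc n := i)) (Suc n)
   = walk_cost \<epsilon> g z n + \<epsilon> * \<bar>i - of_bool (g n)\<bar> + \<bar>i - z n\<bar>"
  using walk_cost_cong[of n "z(Suc n := i)" z \<epsilon> g] by (simp add: walk_cost_def)

lemma walk_cost_stop: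
  assumes "\<And>n. z n \<in> {0, 1}" "0 \<le> \<epsilon>"
  shows "walk_cost \<epsilon> g (\<lambda>n. z (min n N)) (N + k) \<le> walk_cost \<epsilon> g z N + \<epsilon> * real k"
proof (induction k)
  case 0
  then show ?case
    using walk_cost_cong[of N "\<lambda>n. z (min n N)" z \<epsilon> g] by simp
next
  case (Suc k)
  have "\<epsilon> * \<bar>z N - of_bool (g (N + k))\<bar> \<le> \<epsilon> * 1"
    by (rule mult_left_mono) (use assms(1)[of N] assms(2) in auto)
  with Suc show ?case
    by (simp add: walk_cost_def algebra_simps)
qed

section \<open>Loads that encode a walk\<close>

definition hard_cost :: "real \<Rightarrow> real \<Rightarrow> real" where
  "hard_cost \<epsilon> z = \<epsilon> * \<bar>1 - 2 * z\<bar>"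

definition hard_load :: "bool \<Rightarrow> real" where
  "hard_load g = (if g then 1 else 1 / 2)"

definition hard_loads :: "(nat \<Rightarrow> bool) \<Rightarrow> nat \<Rightarrow> real list" where
  "hard_loads g T = map (\<lambda>n. hard_load (g n)) [0..<T]"

lemma length_hard_loads: "length (hard_loads g T) = T"
  by (simp add: hard_loads_def)

lemma nth_hard_loads: "n < T \<Longrightarrow> hard_loads g T ! n = hard_load (g n)"
  by (simp add: hard_loads_def)

lemma take_hard_loads: "k \<le> T \<Longrightarrow> take k (hard_loads g T) = hard_loads g k"
  by (simp add: hard_loads_def take_map take_upt)

lemma restricted_instance_hard:
  assumes "0 \<le> \<epsilon>"
  shows "restricted_instance 2 2 (hard_cost \<epsilon>) (hard_loads g T)"
proof -
  have "convex_on {0..1} (hard_cost \<epsilon>)"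
  proof (rule convex_onI)
    fix t x y :: real
    assume t: "0 < t" "t < 1"
    have "\<bar>1 - 2 * ((1 - t) * x + t * y)\<bar> = \<bar>(1 - t) * (1 - 2 * x) + t * (1 - 2 * y)\<bar>"
      by (simp add: algebra_simps)
    also have "\<dots> \<le> (1 - t) * \<bar>1 - 2 * x\<bar> + t * \<bar>1 - 2 * y\<bar>"
      using t abs_triangle_ineq[of "(1 - t) * (1 - 2 * x)" "t * (1 - 2 * y)"] by (simp add: abs_mult)
    finally have "\<epsilon> * \<bar>1 - 2 * ((1 - t) * x + t * y)\<bar> \<le> \<epsilon> * ((1 - t) * \<bar>1 - 2 * x\<bar> + t * \<bar>1 - 2 * y\<bar>)"
      using assms by (rule mult_left_mono)
    then show "hard_cost \<epsilon> ((1 - t) *\<^sub>R x + t *\<^sub>R y)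
        \<le> (1 - t) * hard_cost \<epsilon> x + t * hard_cost \<epsilon> y"
      by (simp add: hard_cost_def algebra_simps)
  qed simp
  then show ?thesis
    using assms
    by (auto simp: restricted_instance_def hard_cost_def hard_loads_def hard_load_def)
qed

lemma hard_operating_cost:
  assumes "0 < x"
  shows "x * hard_cost \<epsilon> (hard_load b / x) = \<epsilon> * \<bar>x - 1 - of_bool b\<bar>"
proof -
  have "x * \<bar>1 - 2 * (hard_load b / x)\<bar> = \<bar>x * (1 - 2 * (hard_load b / x))\<bar>"
    using assms by (simp add: abs_mult)
  also have "x * (1 - 2 * (hard_load b / x)) = x - 1 - of_bool b"
    using assms by (auto simp: hard_load_def field_simps)
  finally show ?thesis
    by (simp add: hard_cost_def)
qed

lemma hard_schedule_cost:
  assumes "\<And>t. t \<in> {1..T} \<Longrightarrow> 0 < x t"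
  shows "schedule_cost 2 (hard_cost \<epsilon>) (hard_loads g T) x
    = (\<Sum>n<T. \<epsilon> * \<bar>x (Suc n) - 1 - of_bool (g n)\<bar> + 2 * max 0 (x (Suc n) - x n))"
proof -
  have eq: "(\<Sum>t = 1..T. h t) = (\<Sum>n<T. h (Suc n))" for h :: "nat \<Rightarrow> real"
    by (simp add: sum.atLeast1_atMost_eq)
  have "(\<Sum>n<T. x (Suc n) * hard_cost \<epsilon> (hard_loads g T ! n / x (Suc n)))
      = (\<Sum>n<T. \<epsilon> * \<bar>x (Suc n) - 1 - of_bool (g n)\<bar>)"
    by (rule sum.cong) (use assms in \<open>auto simp: nth_hard_loads hard_operating_cost\<close>)
  then show ?thesis
    by (simp add: schedule_cost_def length_hard_loads eq sum.distrib sum_distrib_left del: One_nat_def)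
qed

text \<open>Each term is \<open>\<bar>d\<bar> + d\<close> for the increment \<open>d\<close>, and
  the increments telescope.\<close>

lemma sum_max_0_diff:
  fixes z :: "nat \<Rightarrow> real"
  shows "(\<Sum>n<N. 2 * max 0 (z (Suc n) - z n)) = variation z N + z N - z 0"
proof (induction N)
  case (Suc N)
  then show ?case
    by (simp add: variation_Suc max_def)
qed (simp add: variation_def)

text \<open>Clipping \<open>x - 1\<close> at \<open>0\<close> moves it no farther from either target
  and enlarges no upward move. The costs after time \<open>N\<close> are nonnegative and
  dropped.\<close>

lemma schedule_cost_ge_walk_cost:
  assumes x: "feasible S (hard_loads g (N + k)) x" and "0 \<le> \<epsilon>"
  shows "walk_cost \<epsilon> g (\<lambda>n. max 0 (x n - 1)) N
    \<le> schedule_cost 2 (hard_cost \<epsilon>) (hard_loads g (N + k)) x"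
proof -
  let ?a = "\<lambda>n. max 0 (x n - 1)"
  have pos: "0 < x t" if "t \<in> {1..N + k}" for t
  proof -
    have "hard_load (g (t - 1)) \<le> x t"
      using x that nth_hard_loads[of "t - 1" "N + k" g] unfolding feasible_def length_hard_loads
      by fastforce
    then show "0 < x t"
      by (auto simp: hard_load_def split: if_splits)
  qed
  have x0: "x 0 = 0"
    using x by (simp add: feasible_def)
  have "walk_cost \<epsilon> g ?a N = (\<Sum>n<N. \<epsilon> * \<bar>?a (Suc n) - of_bool (g n)\<bar>) + variation ?a N"
    by (simp add: walk_cost_def variation_def sum.distrib)
  also have "\<dots> \<le> (\<Sum>n<N. \<epsilon> * \<bar>?a (Suc n) - of_bool (g n)\<bar>) + (\<Sum>n<N. 2 * max 0 (?a (Suc n) - ?a n))"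
    unfolding sum_max_0_diff[of ?a] using x0 by simp
  also have "\<dots> \<le> (\<Sum>n<N. \<epsilon> * \<bar>x (Suc n) - 1 - of_bool (g n)\<bar> + 2 * max 0 (x (Suc n) - x n))"
    unfolding sum.distrib[symmetric]
    by (intro sum_mono add_mono mult_left_mono) (use assms(2) in auto)
  also have "\<dots> \<le> (\<Sum>n<N + k. \<epsilon> * \<bar>x (Suc n) - 1 - of_bool (g n)\<bar> + 2 * max 0 (x (Suc n) - x n))"
    by (rule sum_mono2) (use assms(2) in auto)
  also have "\<dots> = schedule_cost 2 (hard_cost \<epsilon>) (hard_loads g (N + k)) x"
    using pos by (subst hard_schedule_cost) auto
  finally show ?thesis .
qed

lemma schedule_cost_hard_nonneg:
  assumes "feasible S (hard_loads g T) x" "0 \<le> \<epsilon>"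
  shows "0 \<le> schedule_cost 2 (hard_cost \<epsilon>) (hard_loads g T) x"
  using schedule_cost_ge_walk_cost[of S g 0 T x \<epsilon>] assms by (simp add: walk_cost_def)

lemma opt_cost_hard_nonneg:
  assumes "feasible S (hard_loads g T) x" "0 \<le> \<epsilon>"
  shows "0 \<le> opt_cost S 2 (hard_cost \<epsilon>) (hard_loads g T)"
  unfolding opt_cost_def
  by (rule cINF_greatest) (use assms schedule_cost_hard_nonneg in auto)

text \<open>The witness is the schedule \<open>1 + z\<close>, frozen after time \<open>N\<close>.
  The \<open>4\<close> covers the initial rise from \<open>0\<close> and the end terms left by
  telescoping.\<close>

lemma opt_cost_hard_le:
  assumes S: "{1, 2} \<subseteq> S" and z: "\<And>n. z n \<in> {0, 1}" and \<epsilon>: "0 \<le> \<epsilon>"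
  shows "opt_cost S 2 (hard_cost \<epsilon>) (hard_loads g (N + k)) \<le> walk_cost \<epsilon> g z N + \<epsilon> * real k + 4"
proof -
  let ?T = "N + k"
  let ?z = "\<lambda>n. z (min n N)"
  define x where "x t = (if t = 0 then 0 else 1 + ?z t)" for t
  have z': "z n = 0 \<or> z n = 1" for n
    using z[of n] by auto
  have z01: "0 \<le> z n" "z n \<le> 1" for n
    using z'[of n] by auto
  have "x t \<in> S \<and> hard_load b \<le> x t" if "1 \<le> t" for t b
    using z'[of "min t N"] that S by (auto simp: x_def hard_load_def)
  then have feas: "feasible S (hard_loads g ?T) x"
    by (auto simp: feasible_def length_hard_loads nth_hard_loads x_def[of 0])
  have "opt_cost S 2 (hard_cost \<epsilon>) (hard_loads g ?T)
      \<le> schedule_cost 2 (hard_cost \<epsilon>) (hard_loads g ?T) x"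
    unfolding opt_cost_def
  proof (rule cINF_lower)
    show "bdd_below (schedule_cost 2 (hard_cost \<epsilon>) (hard_loads g ?T) ` {x. feasible S (hard_loads g ?T) x})"
      using schedule_cost_hard_nonneg[OF _ \<epsilon>] by (intro bdd_belowI[of _ 0]) auto
  qed (use feas in simp)
  also have "\<dots> = (\<Sum>n<?T. \<epsilon> * \<bar>x (Suc n) - 1 - of_bool (g n)\<bar> + 2 * max 0 (x (Suc n) - x n))"
    using z01 by (intro hard_schedule_cost) (auto simp: x_def add_pos_nonneg)
  also have "\<dots> \<le> (\<Sum>n<?T. \<epsilon> * \<bar>?z (Suc n) - of_bool (g n)\<bar> + 2 * max 0 (?z (Suc n) - ?z n)
      + (if n = 0 then 2 * (1 + z 0) else 0))"
  proof (rule sum_mono)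
    fix n
    have "max 0 (x (Suc n) - x n) \<le> max 0 (?z (Suc n) - ?z n) + (if n = 0 then 1 + z 0 else 0)"
      using z01(1)[of 0] z01(1)[of "min 1 N"] by (auto simp: x_def)
    moreover have "x (Suc n) - 1 = ?z (Suc n)"
      by (simp add: x_def)
    ultimately show "\<epsilon> * \<bar>x (Suc n) - 1 - of_bool (g n)\<bar> + 2 * max 0 (x (Suc n) - x n)
      \<le> \<epsilon> * \<bar>?z (Suc n) - of_bool (g n)\<bar> + 2 * max 0 (?z (Suc n) - ?z n)
        + (if n = 0 then 2 * (1 + z 0) else 0)"
      by (simp split: if_splits del: max.bounded_iff)
  qed
  also have "\<dots> \<le> (\<Sum>n<?T. \<epsilon> * \<bar>?z (Suc n) - of_bool (g n)\<bar>) + variation ?z ?T + ?z ?T - z 0 + 2 * (1 + z 0)"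
    unfolding sum.distrib using z01(1)[of 0] sum_max_0_diff[where z = ?z and N = ?T] by simp
  also have "\<dots> \<le> walk_cost \<epsilon> g ?z ?T + 4"
    using z01(2)[of "min ?T N"] z01(2)[of 0] by (simp add: walk_cost_def variation_def sum.distrib)
  also have "\<dots> \<le> walk_cost \<epsilon> g z N + \<epsilon> * real k + 4"
    using walk_cost_stop[of z \<epsilon> g N k] z \<epsilon> by simp
  finally show ?thesis .
qed

section \<open>The adversary built from the online algorithm\<close>

lemma ex_history_dependent_sequence: "\<exists>g :: nat \<Rightarrow> 'a. \<forall>n. g n = F (map g [0..<n])"
proof -
  define L where "L = rec_nat [] (\<lambda>_ l. l @ [F l])"
  have "L n = map (\<lambda>k. F (L k)) [0..<n]" for n
    by (induction n) (auto simp: L_def)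
  then show ?thesis
    by (intro exI[of _ "\<lambda>n. F (L n)"]) metis
qed

text \<open>
  The instances have length \<open>N + w\<close>, so that none of the decisions up to time \<open>N\<close> depends on \<open>N\<close>.
\<close>

lemma competitive_walk:
  assumes A: "achieves_competitive_ratio S w A c" and S: "{1, 2} \<subseteq> S 2" and \<epsilon>: "0 \<le> \<epsilon>"
  obtains g :: "nat \<Rightarrow> bool" and a :: "nat \<Rightarrow> real"
  where "\<And>n. a n \<in> (\<lambda>s. max 0 (s - 1)) ` S 2"
    and "\<And>n. g n = F (map g [0..<n]) (a (n - w))"
    and "\<And>N z. (\<And>n. z n \<in> {0, 1}) \<Longrightarrow>
      walk_cost \<epsilon> g a N \<le> max 0 c * (walk_cost \<epsilon> g z N + \<epsilon> * real w + 4)"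
proof -
  let ?f = "hard_cost \<epsilon>"
  define state where "state t l = (if t = 0 then 0 else A 2 2 ?f t (map hard_load l))" for t l
  \<comment> \<open>No circularity: for \<open>w \<le> n\<close> the decision at time
    \<open>n - w\<close> sees just the first \<open>n\<close> loads, and for \<open>n < w\<close> it
    is the fixed start.\<close>
  obtain g where g: "\<And>n. g n = F (map g [0..<n]) (max 0 (state (n - w) (map g [0..<n]) - 1))"
    using ex_history_dependent_sequence[of "\<lambda>l. F l (max 0 (state (length l - w) l - 1))"] by auto
  define x where "x t = state t (map g [0..<t + w])" for t
  define a where "a n = max 0 (x n - 1)" for n
  have online: "online_schedule w A 2 2 ?f (hard_loads g (N + w)) t = x t" if "t \<le> N" for N t
    using that by (simp add: online_schedule_def take_hard_loads x_def state_def)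
      (simp add: hard_loads_def comp_def)
  have feas: "feasible (S 2) (hard_loads g T) (online_schedule w A 2 2 ?f (hard_loads g T))"
    and ratio: "schedule_cost 2 ?f (hard_loads g T) (online_schedule w A 2 2 ?f (hard_loads g T))
      \<le> c * opt_cost (S 2) 2 ?f (hard_loads g T)" for T
    using A restricted_instance_hard[OF \<epsilon>, of g T] unfolding achieves_competitive_ratio_def by auto
  show ?thesis
  proof
    fix n
    show "a n \<in> (\<lambda>s. max 0 (s - 1)) ` S 2"
    proof (cases "n = 0")
      case True
      \<comment> \<open>The start state \<open>0\<close> need not lie in \<open>S 2\<close>, but
        state \<open>1\<close> has the same position.\<close>
      then have "a n = max 0 (1 - 1)"
        by (simp add: a_def x_def state_def)
      then show ?thesis
        using S by blast
    next
      case False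
      then have "x n \<in> S 2"
        using feas[of "n + w"] online[of n n] unfolding feasible_def length_hard_loads
        by (auto dest!: bspec[of _ _ n])
      then show ?thesis
        by (auto simp: a_def)
    qed
    show "g n = F (map g [0..<n]) (a (n - w))"
    proof (cases "w \<le> n")
      case True
      then show ?thesis
        using g[of n] by (simp add: a_def x_def)
    next
      case False
      then show ?thesis
        using g[of n] by (simp add: a_def x_def state_def)
    qed
  next
    fix N and z :: "nat \<Rightarrow> real"
    assume z: "\<And>n. z n \<in> {0, 1}"
    let ?x = "online_schedule w A 2 2 ?f (hard_loads g (N + w))"
    let ?opt = "opt_cost (S 2) 2 ?f (hard_loads g (N + w))"
    have "walk_cost \<epsilon> g a N = walk_cost \<epsilon> g (\<lambda>n. max 0 (?x n - 1)) N"
      by (rule walk_cost_cong) (simp add: online a_def)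
    also have "\<dots> \<le> schedule_cost 2 ?f (hard_loads g (N + w)) ?x"
      by (rule schedule_cost_ge_walk_cost[OF feas \<epsilon>])
    also have "\<dots> \<le> c * ?opt"
      by (rule ratio)
    also have "\<dots> \<le> max 0 c * ?opt"
      using opt_cost_hard_nonneg[OF feas \<epsilon>] by (intro mult_right_mono) auto
    also have "\<dots> \<le> max 0 c * (walk_cost \<epsilon> g z N + \<epsilon> * real w + 4)"
      by (intro mult_left_mono opt_cost_hard_le S z \<epsilon>) auto
    finally show "walk_cost \<epsilon> g a N \<le> max 0 c * (walk_cost \<epsilon> g z N + \<epsilon> * real w + 4)" .
  qed
qed

section \<open>Lower bound 3 in the discrete setting\<close>

lemma discrete_lower_bound:
  assumes A: "achieves_competitive_ratio discrete_states w A (3 - d)" and d: "0 < d"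
  shows False
proof -
  \<comment> \<open>Capping keeps \<open>3 - \<delta>\<close> nonnegative, so that it may multiply
    inequalities.\<close>
  define \<delta> where "\<delta> = min d 3"
  have \<delta>: "0 < \<delta>" "\<delta> \<le> 3" and max: "max 0 (3 - d) = 3 - \<delta>"
    using d by (auto simp: \<delta>_def)
  define \<epsilon> where "\<epsilon> = \<delta> / (6 * (real w + 1))"
  have \<epsilon>: "0 < \<epsilon>" "\<epsilon> * (real w + 1) = \<delta> / 6"
    using \<delta> by (auto simp: \<epsilon>_def field_simps)
  have \<epsilon>w: "\<epsilon> * real w \<le> 1"
    using \<epsilon> \<delta> by (simp add: algebra_simps)
  have states: "{1, 2} \<subseteq> discrete_states 2"
    by (force simp: discrete_states_def)
  obtain g a where a: "\<And>n. a n \<in> (\<lambda>s. max 0 (s - 1)) ` discrete_states 2"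
    and g: "\<And>n. g n = (a (n - w) = 0)"
    and ratio: "\<And>N z. (\<And>n. z n \<in> {0, 1}) \<Longrightarrow>
      walk_cost \<epsilon> g a N \<le> (3 - \<delta>) * (walk_cost \<epsilon> g z N + \<epsilon> * real w + 4)"
    using competitive_walk[OF A states less_imp_le[OF \<epsilon>(1)], of "\<lambda>_ s. s = 0"] unfolding max by metis
  have a01: "a n = 0 \<or> a n = 1" for n
  proof -
    obtain k :: nat where "k \<le> 2" "a n = max 0 (real k - 1)"
      using a[of n] by (auto simp: discrete_states_def)
    then show ?thesis
      by (cases k) auto
  qed
  \<comment> \<open>This walk always sits on the target, and its moves mirror those of the delayed
    position. As \<open>0 - 1 = 0\<close>, it starts on the first target and pays no initial
    move.\<close>
  define z where "z n = (of_bool (g (n - 1)) :: real)" for n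
  have E: "delayed_cost \<epsilon> w g a N = \<epsilon> * real N" for N
  proof -
    have "\<bar>a (n - w) - of_bool (g n)\<bar> = 1" for n
      using a01[of "n - w"] g[of n] by auto
    then show ?thesis
      by (simp add: delayed_cost_def)
  qed
  have bound: "\<delta> / 6 * (\<epsilon> * real N) \<le> 15" for N
  proof -
    let ?V = "variation a N"
    have "walk_cost \<epsilon> g (\<lambda>_. 0) N + walk_cost \<epsilon> g (\<lambda>_. 1) N
        = (\<Sum>n<N. \<epsilon> * \<bar>0 - of_bool (g n)\<bar> + \<epsilon> * \<bar>1 - of_bool (g n)\<bar>)"
      by (simp add: walk_cost_def sum.distrib)
    also have "\<dots> = (\<Sum>n<N. \<epsilon>)"
      by (rule sum.cong) auto
    finally have const: "walk_cost \<epsilon> g (\<lambda>_. 0) N + walk_cost \<epsilon> g (\<lambda>_. 1) N = \<epsilon> * real N"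
      by simp
    have "walk_cost \<epsilon> g z N = (\<Sum>n<N. \<bar>a (n - w) - a (n - Suc w)\<bar>)"
      unfolding walk_cost_def
    proof (rule sum.cong)
      fix n
      show "\<epsilon> * \<bar>z (Suc n) - of_bool (g n)\<bar> + \<bar>z (Suc n) - z n\<bar> = \<bar>a (n - w) - a (n - Suc w)\<bar>"
        using a01[of "n - w"] a01[of "n - Suc w"] by (auto simp: z_def g)
    qed simp
    then have opposite: "walk_cost \<epsilon> g z N \<le> ?V"
      using variation_delay[of a w N] by simp
    have le: "walk_cost \<epsilon> g a N \<le> (3 - \<delta>) * (walk_cost \<epsilon> g y N + 5)" if "\<And>n. y n \<in> {0, 1}" for y
    proof -
      have "walk_cost \<epsilon> g a N \<le> (3 - \<delta>) * (walk_cost \<epsilon> g y N + \<epsilon> * real w + 4)"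
        using ratio[of y N] that \<delta> by simp
      also have "\<dots> \<le> (3 - \<delta>) * (walk_cost \<epsilon> g y N + 5)"
        using \<epsilon>w \<delta> by (intro mult_left_mono) auto
      finally show ?thesis .
    qed
    have "3 * walk_cost \<epsilon> g a N
        \<le> (3 - \<delta>) * (walk_cost \<epsilon> g (\<lambda>_. 0) N + walk_cost \<epsilon> g (\<lambda>_. 1) N + walk_cost \<epsilon> g z N + 15)"
      using le[of "\<lambda>_. 0"] le[of "\<lambda>_. 1"] le[of z] by (simp add: z_def algebra_simps)
    also have "\<dots> \<le> (3 - \<delta>) * (\<epsilon> * real N + ?V + 15)"
      using const opposite \<delta> by (intro mult_left_mono) auto
    finally have "3 * walk_cost \<epsilon> g a N \<le> (3 - \<delta>) * (\<epsilon> * real N + ?V + 15)" .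
    moreover have "(1 - \<delta> / 6) * (\<epsilon> * real N + ?V) \<le> walk_cost \<epsilon> g a N"
      using walk_cost_ge_delayed[of \<epsilon> w g a N] \<epsilon> E by simp
    \<comment> \<open>The factor \<open>3 * (1 - \<delta> / 6)\<close> exceeds
      \<open>3 - \<delta>\<close> by \<open>\<delta> / 2\<close>.\<close>
    ultimately have "\<delta> / 2 * (\<epsilon> * real N + ?V) \<le> 15 * (3 - \<delta>)"
      by (simp add: algebra_simps)
    moreover have "0 \<le> \<delta> * ?V"
      using \<delta> variation_nonneg by simp
    ultimately show ?thesis
      using \<delta> by (simp add: algebra_simps)
  qed
  have "0 < \<delta> / 6 * \<epsilon>"
    using \<epsilon>(1) \<delta>(1) by simp
  then obtain N where "15 < real N * (\<delta> / 6 * \<epsilon>)"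
    using reals_Archimedean3 by blast
  then show False
    using bound[of N] by (simp add: algebra_simps)
qed

section \<open>Work function and barycenter\<close>

text \<open>If \<open>w0\<close> and \<open>w1\<close> are the work function values of the two
  states, then \<open>b = (1 + w0 - w1) / 2\<close>. Truncation to \<open>[0,1]\<close> reflects
  \<open>\<bar>w0 - w1\<bar> \<le> 1\<close>.\<close>

definition barycenter_step :: "real \<Rightarrow> real \<Rightarrow> bool \<Rightarrow> real" where
  "barycenter_step \<epsilon> b g = (if g then min 1 (b + \<epsilon> / 2) else max 0 (b - \<epsilon> / 2))"

lemma barycenter_step_bounds:
  "\<lbrakk>0 \<le> \<epsilon>; 0 \<le> b; b \<le> 1\<rbrakk> \<Longrightarrow> 0 \<le> barycenter_step \<epsilon> b g"
  "\<lbrakk>0 \<le> \<epsilon>; 0 \<le> b; b \<le> 1\<rbrakk> \<Longrightarrow> barycenter_step \<epsilon> b g \<le> 1"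
  by (auto simp: barycenter_step_def)

text \<open>
  The terms \<open>\<bar>z n\<bar>\<close> and \<open>\<bar>1 - z n\<bar>\<close> charge a final move to \<open>0\<close> and \<open>1\<close> after the last operating cost, so
  that the two bounds, like the work function, differ by at most \<open>1\<close>.
\<close>

lemma work_function_bound:
  fixes b :: "nat \<Rightarrow> real"
  assumes \<epsilon>: "0 \<le> \<epsilon>" and b0: "b 0 = 1 / 2"
    and b: "\<And>n. b (Suc n) = barycenter_step \<epsilon> (b n) (g n)"
  shows "(\<exists>z. (\<forall>k. z k \<in> {0, 1}) \<and> walk_cost \<epsilon> g z n + \<bar>z n\<bar> \<le> variation b n + b n - 1 / 2) \<and>
         (\<exists>z. (\<forall>k. z k \<in> {0, 1}) \<and> walk_cost \<epsilon> g z n + \<bar>1 - z n\<bar> \<le> variation b n - b n + 1 / 2)"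
proof (induction n)
  case 0
  show ?case
    by (intro conjI exI[of _ "\<lambda>_. 0"] exI[of _ "\<lambda>_. 1"]) (auto simp: walk_cost_def variation_def b0)
next
  case (Suc n)
  have bn: "0 \<le> b n \<and> b n \<le> 1"
    by (induction n) (auto simp: b0 b barycenter_step_bounds \<epsilon>)
  obtain z0 z1 where z: "\<And>k. z0 k \<in> {0, 1}" "\<And>k. z1 k \<in> {0, 1}"
    and z0: "walk_cost \<epsilon> g z0 n + \<bar>z0 n\<bar> \<le> variation b n + b n - 1 / 2"
    and z1: "walk_cost \<epsilon> g z1 n + \<bar>1 - z1 n\<bar> \<le> variation b n - b n + 1 / 2"
    using Suc by metis
  \<comment> \<open>The final move charged so far becomes an actual one.\<close>
  let ?y0 = "z0(Suc n := 0)" and ?y1 = "z1(Suc n := 1)"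
  have y: "\<forall>k. ?y0 k \<in> {0, 1}" "\<forall>k. ?y1 k \<in> {0, 1}"
    using z by auto
  have c0: "walk_cost \<epsilon> g ?y0 (Suc n) \<le> variation b n + b n - 1 / 2 + \<epsilon> * of_bool (g n)"
    using z0 by (simp add: walk_cost_upd)
  have c1: "walk_cost \<epsilon> g ?y1 (Suc n) \<le> variation b n - b n + 1 / 2 + \<epsilon> * of_bool (\<not> g n)"
    using z1 by (simp add: walk_cost_upd of_bool_def)
  show ?case
  proof (cases "g n")
    case True
    then have step: "b (Suc n) = min 1 (b n + \<epsilon> / 2)"
      by (simp add: b barycenter_step_def)
    have V: "variation b (Suc n) = variation b n + b (Suc n) - b n"
      using step bn \<epsilon> by (simp add: variation_Suc)
    have 1: "walk_cost \<epsilon> g ?y1 (Suc n) + \<bar>1 - ?y1 (Suc n)\<bar> \<le> variation b (Suc n) - b (Suc n) + 1 / 2"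
      using c1 True V by simp
    show ?thesis
    proof (cases "b n + \<epsilon> / 2 \<le> 1")
      case le: True
      have "walk_cost \<epsilon> g ?y0 (Suc n) + \<bar>?y0 (Suc n)\<bar> \<le> variation b (Suc n) + b (Suc n) - 1 / 2"
        using c0 True V step le by simp
      with 1 y show ?thesis
        by blast
    next
      case False
      \<comment> \<open>Here \<open>b\<close> is truncated at \<open>1\<close>, and the good way to
        reach \<open>0\<close> is to end at \<open>1\<close> and then move.\<close>
      have "walk_cost \<epsilon> g ?y1 (Suc n) + \<bar>?y1 (Suc n)\<bar> \<le> variation b (Suc n) + b (Suc n) - 1 / 2"
        using c1 True V step False by simp
      with 1 y show ?thesis
        by blast
    qed
  next
    case False
    then have step: "b (Suc n) = max 0 (b n - \<epsilon> / 2)"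
      by (simp add: b barycenter_step_def)
    have V: "variation b (Suc n) = variation b n + b n - b (Suc n)"
      using step bn \<epsilon> by (simp add: variation_Suc)
    have 0: "walk_cost \<epsilon> g ?y0 (Suc n) + \<bar>?y0 (Suc n)\<bar> \<le> variation b (Suc n) + b (Suc n) - 1 / 2"
      using c0 False V by simp
    show ?thesis
    proof (cases "0 \<le> b n - \<epsilon> / 2")
      case le: True
      have "walk_cost \<epsilon> g ?y1 (Suc n) + \<bar>1 - ?y1 (Suc n)\<bar> \<le> variation b (Suc n) - b (Suc n) + 1 / 2"
        using c1 False V step le by simp
      with 0 y show ?thesis
        by blast
    next
      case neg: False
      have "walk_cost \<epsilon> g ?y0 (Suc n) + \<bar>1 - ?y0 (Suc n)\<bar> \<le> variation b (Suc n) - b (Suc n) + 1 / 2"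
        using c0 False V step neg by simp
      with 0 y show ?thesis
        by blast
    qed
  qed
qed

section \<open>A potential relating the delayed position to the barycenter\<close>

text \<open>
  Up to terms in \<open>b\<close> alone, the potential depends on the signed distance \<open>u\<close> of the barycenter from
  the threshold. For \<open>\<theta> = 0\<close> it arises by requiring slope \<open>-2 (1 - a)\<close> in \<open>b\<close> below the threshold,
  slope \<open>2 a\<close> above it, and a Lipschitz constant \<open>1\<close> in \<open>a\<close>. The margin \<open>\<theta>\<close> makes the algorithm pay
  in every step; with threshold \<open>a\<close> it could keep its cost bounded by resting near an end point.
\<close>

definition lag_potential :: "real \<Rightarrow> real \<Rightarrow> real \<Rightarrow> real" where
  "lag_potential \<theta> a b =
     (let K = 1 + 2 * \<theta>; u = K * a - \<theta> - b in \<bar>u\<bar> - u\<^sup>2 / K + (\<theta> + b)\<^sup>2 / K - b)"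

text \<open>In \<open>v = \<bar>u\<bar>\<close> the potential is \<open>v - v\<^sup>2 / K\<close> up
  to a constant, with slope in \<open>[-1,1]\<close> because \<open>v \<le> K\<close>; and
  \<open>u\<close> has slope \<open>K\<close> in \<open>a\<close>.\<close>

lemma lag_potential_lipschitz:
  assumes "0 \<le> \<theta>" "a \<in> {0..1}" "a' \<in> {0..1}" "b \<in> {0..1}"
  shows "\<bar>lag_potential \<theta> a b - lag_potential \<theta> a' b\<bar> \<le> (1 + 2 * \<theta>) * \<bar>a - a'\<bar>"
proof -
  define K u u' where "K = 1 + 2 * \<theta>" and "u = K * a - \<theta> - b" and "u' = K * a' - \<theta> - b"
  have K: "0 < K"
    using assms by (simp add: K_def)
  have "0 \<le> K * a" "K * a \<le> K" "0 \<le> K * a'" "K * a' \<le> K"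
    using assms K by (auto intro!: mult_left_le)
  moreover have "K = 1 + 2 * \<theta>" "0 \<le> b" "b \<le> 1"
    using assms by (auto simp: K_def)
  ultimately have u: "\<bar>u\<bar> \<le> K" "\<bar>u'\<bar> \<le> K"
    using \<open>0 \<le> \<theta>\<close> unfolding u_def u'_def by linarith+
  have "lag_potential \<theta> a b - lag_potential \<theta> a' b = \<bar>u\<bar> - \<bar>u'\<bar> - (\<bar>u\<bar>\<^sup>2 - \<bar>u'\<bar>\<^sup>2) / K"
    by (simp add: lag_potential_def Let_def K_def[symmetric] u_def[symmetric] u'_def[symmetric]
        diff_divide_distrib)
  also have "\<dots> = (\<bar>u\<bar> - \<bar>u'\<bar>) * (1 - (\<bar>u\<bar> + \<bar>u'\<bar>) / K)"
    using K by (simp add: field_simps power2_eq_square)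
  finally have "\<bar>lag_potential \<theta> a b - lag_potential \<theta> a' b\<bar>
      = \<bar>\<bar>u\<bar> - \<bar>u'\<bar>\<bar> * \<bar>1 - (\<bar>u\<bar> + \<bar>u'\<bar>) / K\<bar>"
    by (simp add: abs_mult)
  also have "\<dots> \<le> \<bar>u - u'\<bar> * 1"
  proof (intro mult_mono)
    have "0 \<le> (\<bar>u\<bar> + \<bar>u'\<bar>) / K" "(\<bar>u\<bar> + \<bar>u'\<bar>) / K \<le> 2"
      using K u by (auto simp: field_simps)
    then show "\<bar>1 - (\<bar>u\<bar> + \<bar>u'\<bar>) / K\<bar> \<le> 1"
      by linarith
  qed auto
  also have "u - u' = K * (a - a')"
    by (simp add: u_def u'_def algebra_simps)
  finally show ?thesis
    using K by (simp add: abs_mult K_def)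
qed

text \<open>The squares of \<open>\<theta> + b\<close> cancel, so only the absolute value is not
  affine in \<open>b\<close>.\<close>

lemma lag_potential_eq:
  assumes "0 \<le> \<theta>"
  shows "lag_potential \<theta> a b = \<bar>(1 + 2 * \<theta>) * a - \<theta> - b\<bar> - (1 + 2 * \<theta>) * a\<^sup>2 + 2 * a * (\<theta> + b) - b"
proof -
  define K where "K = 1 + 2 * \<theta>"
  have K: "K \<noteq> 0"
    using assms by (simp add: K_def)
  have "(\<theta> + b)\<^sup>2 / K - (K * a - \<theta> - b)\<^sup>2 / K = - K * a\<^sup>2 + 2 * a * (\<theta> + b)"
    using K by (simp add: field_simps power2_eq_square)
  then show ?thesis
    by (simp add: lag_potential_def Let_def K_def[symmetric])
qed

lemma lag_potential_bounds:
  assumes "0 \<le> \<theta>" "\<theta> \<le> 1" "a \<in> {0..1}" "b \<in> {0..1}"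
  shows "\<bar>lag_potential \<theta> a b\<bar> \<le> 4"
proof -
  have ab: "0 \<le> a" "a \<le> 1" "0 \<le> b" "b \<le> 1"
    using assms by auto
  have base: "lag_potential \<theta> 0 b = \<theta>"
    using assms ab by (simp add: lag_potential_eq)
  have "\<bar>lag_potential \<theta> a b - lag_potential \<theta> 0 b\<bar> \<le> (1 + 2 * \<theta>) * \<bar>a - 0\<bar>"
    using assms by (intro lag_potential_lipschitz) auto
  also have "\<dots> \<le> 3 * 1"
    using assms ab by (intro mult_mono) auto
  finally show ?thesis
    using base assms by linarith
qed

text \<open>
  A step pushes the barycenter away from the threshold, so it never crosses the kink of the
  potential, which is affine in the barycenter on either side.
\<close>

lemma lag_potential_step:
  assumes "0 \<le> \<theta>" "0 \<le> \<epsilon>" "a \<in> {0..1}" "b \<in> {0..1}"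
    and g: "g = ((1 + 2 * \<theta>) * a - \<theta> < b)"
  shows "2 * \<bar>barycenter_step \<epsilon> b g - b\<bar>
    \<le> \<epsilon> * \<bar>a - of_bool g\<bar> + lag_potential \<theta> a (barycenter_step \<epsilon> b g) - lag_potential \<theta> a b"
proof -
  let ?b' = "barycenter_step \<epsilon> b g"
  show ?thesis
  proof (cases g)
    case True
    have d: "0 \<le> ?b' - b" "?b' - b \<le> \<epsilon> / 2"
      using True assms by (auto simp: barycenter_step_def min_def)
    have "lag_potential \<theta> a ?b' - lag_potential \<theta> a b = 2 * a * (?b' - b)"
      using True g d \<open>0 \<le> \<theta>\<close> by (simp add: lag_potential_eq algebra_simps)
    moreover have "(1 - a) * (?b' - b) \<le> (1 - a) * (\<epsilon> / 2)"
      using d assms by (intro mult_left_mono) auto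
    ultimately show ?thesis
      using True d assms by (simp add: algebra_simps)
  next
    case False
    have d: "0 \<le> b - ?b'" "b - ?b' \<le> \<epsilon> / 2"
      using False assms by (auto simp: barycenter_step_def max_def)
    have "lag_potential \<theta> a ?b' - lag_potential \<theta> a b = 2 * (1 - a) * (b - ?b')"
      using False g d \<open>0 \<le> \<theta>\<close> by (simp add: lag_potential_eq algebra_simps)
    moreover have "a * (b - ?b') \<le> a * (\<epsilon> / 2)"
      using d assms by (intro mult_left_mono) auto
    ultimately show ?thesis
      using False d assms by (simp add: algebra_simps)
  qed
qed

text \<open>The threshold leaves \<open>[0,1]\<close> already at distance
  \<open>\<theta> / K\<close> from the end points, where \<open>K = 1 + 2 * \<theta>\<close>. Any
  closer position faces the opposite target, so the delayed cost grows linearly in time.\<close>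

lemma threshold_operating_cost:
  fixes a b \<theta> :: real
  assumes "0 \<le> \<theta>" "b \<in> {0..1}" and g: "g = ((1 + 2 * \<theta>) * a - \<theta> < b)"
  shows "\<theta> / (1 + 2 * \<theta>) \<le> \<bar>a - of_bool g\<bar>"
proof -
  have "\<theta> \<le> (1 + 2 * \<theta>) * \<bar>a - of_bool g\<bar>"
  proof (cases g)
    case True
    have "\<theta> \<le> (1 + 2 * \<theta>) * (1 - a)"
      using True g assms by (auto simp: algebra_simps)
    also have "\<dots> \<le> (1 + 2 * \<theta>) * \<bar>a - of_bool g\<bar>"
      using True assms by (intro mult_left_mono) auto
    finally show ?thesis .
  next
    case False
    have "\<theta> \<le> (1 + 2 * \<theta>) * a"
      using False g assms by auto
    also have "\<dots> \<le> (1 + 2 * \<theta>) * \<bar>a - of_bool g\<bar>"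
      using False assms by (intro mult_left_mono) auto
    finally show ?thesis .
  qed
  then show ?thesis
    using assms by (simp add: field_simps)
qed

section \<open>Lower bound 2 in the continuous setting\<close>

lemma continuous_lower_bound:
  assumes A: "achieves_competitive_ratio continuous_states w A (2 - d)" and d: "0 < d"
  shows False
proof -
  define \<delta> where "\<delta> = min d 2"
  have \<delta>: "0 < \<delta>" "\<delta> \<le> 2" and max: "max 0 (2 - d) = 2 - \<delta>"
    using d by (auto simp: \<delta>_def)
  \<comment> \<open>The delay leaves the factor \<open>2 - \<delta> / 4\<close>, while
    \<open>(2 - \<delta>) * K \<le> 2 - 3 * \<delta> / 4\<close>; the gap is
    \<open>\<delta> / 2\<close>.\<close>
  define \<epsilon> \<theta> K where "\<epsilon> = \<delta> / (8 * (real w + 1))" and "\<theta> = \<delta> / 16" and "K = 1 + 2 * \<theta>"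
  have \<epsilon>: "0 < \<epsilon>" "\<epsilon> * (real w + 1) = \<delta> / 8"
    using \<delta> by (auto simp: \<epsilon>_def field_simps)
  have \<epsilon>w: "\<epsilon> * real w \<le> 1"
    using \<epsilon> \<delta> by (simp add: algebra_simps)
  have \<theta>: "0 < \<theta>" "\<theta> \<le> 1" and K: "1 \<le> K"
    using \<delta> by (auto simp: \<theta>_def K_def)
  have states: "{1, 2} \<subseteq> continuous_states 2"
    by (auto simp: continuous_states_def)
  define bar where "bar l = foldl (barycenter_step \<epsilon>) (1 / 2) l" for l
  obtain g a where a: "\<And>n. a n \<in> (\<lambda>s. max 0 (s - 1)) ` continuous_states 2"
    and g: "\<And>n. g n = (K * a (n - w) - \<theta> < bar (map g [0..<n]))"
    and ratio: "\<And>N z. (\<And>n. z n \<in> {0, 1}) \<Longrightarrow>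
      walk_cost \<epsilon> g a N \<le> (2 - \<delta>) * (walk_cost \<epsilon> g z N + \<epsilon> * real w + 4)"
    using competitive_walk[OF A states less_imp_le[OF \<epsilon>(1)], of "\<lambda>l s. K * s - \<theta> < bar l"]
    unfolding max by metis
  have a01: "a n \<in> {0..1}" for n
    using a[of n] by (auto simp: continuous_states_def)
  define b where "b n = bar (map g [0..<n])" for n
  have b0: "b 0 = 1 / 2" and b: "b (Suc n) = barycenter_step \<epsilon> (b n) (g n)" for n
    by (auto simp: b_def bar_def)
  have b01: "b n \<in> {0..1}" for n
    by (induction n) (use \<epsilon> in \<open>auto simp: b0 b barycenter_step_bounds\<close>)
  have g: "g n = ((1 + 2 * \<theta>) * a (n - w) - \<theta> < b n)" for n
    using g[of n] by (simp add: b_def K_def)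
  have bound: "\<delta> / 2 * (\<epsilon> * (\<theta> / K) * real N) \<le> 36" for N
  proof -
    let ?V = "variation a N" and ?E = "delayed_cost \<epsilon> w g a N" and ?W = "variation b N"
    let ?\<Phi> = "\<lambda>n. lag_potential \<theta> (a (n - w)) (b n)"
    \<comment> \<open>First \<open>b\<close> moves with \<open>a\<close> fixed; then
      \<open>a\<close> moves at the Lipschitz price \<open>K\<close>.\<close>
    have "2 * \<bar>b (Suc n) - b n\<bar> \<le> \<epsilon> * \<bar>a (n - w) - of_bool (g n)\<bar>
        + (?\<Phi> (Suc n) - ?\<Phi> n) + K * \<bar>a (Suc n - w) - a (n - w)\<bar>" for n
    proof -
      have "2 * \<bar>b (Suc n) - b n\<bar> \<le> \<epsilon> * \<bar>a (n - w) - of_bool (g n)\<bar>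
          + lag_potential \<theta> (a (n - w)) (b (Suc n)) - ?\<Phi> n"
        using lag_potential_step[OF _ _ a01 b01 g[of n], of \<epsilon>] \<epsilon> \<theta> unfolding b by simp
      moreover have "\<bar>lag_potential \<theta> (a (n - w)) (b (Suc n)) - ?\<Phi> (Suc n)\<bar>
          \<le> K * \<bar>a (Suc n - w) - a (n - w)\<bar>"
        using lag_potential_lipschitz[OF _ a01 a01 b01, of \<theta> "n - w" "Suc n" "Suc n - w"] \<theta>
        by (simp add: K_def abs_minus_commute)
      ultimately show ?thesis
        by linarith
    qed
    then have "(\<Sum>n<N. 2 * \<bar>b (Suc n) - b n\<bar>) \<le> (\<Sum>n<N. \<epsilon> * \<bar>a (n - w) - of_bool (g n)\<bar>
        + (?\<Phi> (Suc n) - ?\<Phi> n) + K * \<bar>a (Suc n - w) - a (n - w)\<bar>)"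
      by (intro sum_mono)
    also have "\<dots> = ?E + (?\<Phi> N - ?\<Phi> 0) + K * variation a (N - w)"
      using sum_lessThan_telescope[of ?\<Phi> N]
      by (simp add: sum.distrib sum_distrib_left[symmetric] variation_delay_Suc delayed_cost_def)
    also have "\<dots> \<le> K * ?E + 8 + K * ?V"
    proof (intro add_mono mult_left_mono variation_mono)
      show "?E \<le> K * ?E"
        using K \<epsilon> mult_right_mono[of 1 K ?E] by (simp add: delayed_cost_def sum_nonneg)
      show "?\<Phi> N - ?\<Phi> 0 \<le> 8"
        using lag_potential_bounds[OF _ _ a01 b01, of \<theta> "N - w" N]
          lag_potential_bounds[OF _ _ a01 b01, of \<theta> "0 - w" 0] \<theta> by simp
    qed (use K in auto)
    finally have W: "2 * ?W \<le> K * (?E + ?V) + 8"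
      by (simp add: variation_def sum_distrib_left algebra_simps)
    have le: "walk_cost \<epsilon> g a N \<le> (2 - \<delta>) * (walk_cost \<epsilon> g y N + 5)" if "\<forall>n. y n \<in> {0, 1}" for y
    proof -
      have "walk_cost \<epsilon> g a N \<le> (2 - \<delta>) * (walk_cost \<epsilon> g y N + \<epsilon> * real w + 4)"
        using ratio[of y N] that \<delta> by simp
      also have "\<dots> \<le> (2 - \<delta>) * (walk_cost \<epsilon> g y N + 5)"
        using \<epsilon>w \<delta> by (intro mult_left_mono) auto
      finally show ?thesis .
    qed
    obtain z0 z1 where z: "\<forall>k. z0 k \<in> {0, 1}" "\<forall>k. z1 k \<in> {0, 1}"
      and z0: "walk_cost \<epsilon> g z0 N + \<bar>z0 N\<bar> \<le> ?W + b N - 1 / 2"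
      and z1: "walk_cost \<epsilon> g z1 N + \<bar>1 - z1 N\<bar> \<le> ?W - b N + 1 / 2"
      using work_function_bound[of \<epsilon> b g N] b0 b \<epsilon> by force
    \<comment> \<open>Adding both comparisons cancels \<open>b N\<close>. The later
      \<open>18\<close> is \<open>10\<close> plus \<open>8\<close> from the potential.\<close>
    have "2 * walk_cost \<epsilon> g a N \<le> (2 - \<delta>) * (walk_cost \<epsilon> g z0 N + walk_cost \<epsilon> g z1 N + 10)"
      using le[OF z(1)] le[OF z(2)] by (simp add: algebra_simps)
    also have "\<dots> \<le> (2 - \<delta>) * (K * (?E + ?V) + 18)"
      using z0 z1 W \<delta> by (intro mult_left_mono) auto
    finally have upper: "2 * walk_cost \<epsilon> g a N \<le> (2 - \<delta>) * K * (?E + ?V) + 18 * (2 - \<delta>)"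
      by (simp add: algebra_simps)
    have "2 * ((1 - \<delta> / 8) * (?E + ?V)) \<le> 2 * walk_cost \<epsilon> g a N"
      using walk_cost_ge_delayed[of \<epsilon> w g a N] \<epsilon> by simp
    also note upper
    also have "(2 - \<delta>) * K * (?E + ?V) + 18 * (2 - \<delta>) \<le> (2 - 3 * \<delta> / 4) * (?E + ?V) + 36"
    proof (intro add_mono mult_right_mono)
      show "(2 - \<delta>) * K \<le> 2 - 3 * \<delta> / 4"
        using \<delta> by (simp add: K_def \<theta>_def field_simps)
      show "0 \<le> ?E + ?V"
        using \<epsilon> variation_nonneg[of a N] by (simp add: delayed_cost_def sum_nonneg)
    qed (use \<delta> in simp)
    finally have "2 * ((1 - \<delta> / 8) * (?E + ?V)) \<le> (2 - 3 * \<delta> / 4) * (?E + ?V) + 36" .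
    then have "\<delta> / 2 * (?E + ?V) \<le> 36"
      by (simp add: algebra_simps)
    moreover have "\<epsilon> * (\<theta> / K) * real N \<le> ?E"
    proof -
      have "(\<Sum>n<N. \<epsilon> * (\<theta> / K)) \<le> ?E"
        unfolding delayed_cost_def K_def using threshold_operating_cost[OF _ b01 g] \<epsilon> \<theta>
        by (intro sum_mono mult_left_mono) auto
      then show ?thesis
        by (simp add: algebra_simps)
    qed
    then have "\<delta> / 2 * (\<epsilon> * (\<theta> / K) * real N) \<le> \<delta> / 2 * (?E + ?V)"
      using \<delta> variation_nonneg[of a N] by (intro mult_left_mono) auto
    ultimately show ?thesis
      by linarith
  qed
  have "0 < \<delta> / 2 * (\<epsilon> * (\<theta> / K))"
    using \<delta> \<epsilon> \<theta> K by simp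
  then obtain N where "36 < real N * (\<delta> / 2 * (\<epsilon> * (\<theta> / K)))"
    using reals_Archimedean3 by blast
  then show False
    using bound[of N] by (simp add: algebra_simps)
qed

theorem theorem5p11:
  fixes w :: nat and \<delta> :: real
  assumes "\<delta> > 0"
  shows "(\<nexists>A. achieves_competitive_ratio discrete_states w A (3 - \<delta>)) \<and>
         (\<nexists>A. achieves_competitive_ratio continuous_states w A (2 - \<delta>))"
proof (intro conjI notI; elim exE)
  fix A
  assume A: "achieves_competitive_ratio discrete_states w A (3 - \<delta>)"
  show False
    by (rule discrete_lower_bound[OF A assms])
next
  fix A
  assume A: "achieves_competitive_ratio continuous_states w A (2 - \<delta>)"
  show False
    by (rule continuous_lower_bound[OF A assms])
qed

end
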